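(* Let $N\ge 3$ and $k\ge 1$ be integers and let $R$ be a partial order on $[k]$. If there exists an $R$ partially ordered avoidance coupling of $k$ walks on the complete graph $K_{N-1}$, then there exists an $R$ partially ordered avoidance coupling of $k+1$ walks on the complete graph $K_{N}$, where for the latter $R$ is regarded as a partial order on $[k+1]$ in which the element $k+1$ is incomparable to every element of $[k]$ (no new relations are added).
   Context: For a positive integer $n$ write $[n]=\{1,\dots,n\}$, and let $S_n$ be the group of permutations of $[n]$. $K_n$ denotes the complete graph (without loops) on vertex set $[n]$. A simple random walk on a graph $G$ with vertex set $[n]$ is a Markov chain $(X_t)_{t\in\mathbb{Z}}$ (indexed by all integers) of elements of $[n]$ such that for all $t\in\mathbb{Z}$, given the past, $X_t$ is uniformly distributed on the neighbors of $X_{t-1}$. Explicitly: for every $t\in\mathbb{Z}$, every $\ell\ge 1$, every history $w_{t-\ell},\dots,w_{t-1}\in[n]$ with $\mathbb{P}(X_{t-1}=w_{t-1},\dots,X_{t-\ell}=w_{t-\ell})>0$ and every neighbor $v$ of $w_{t-1}$, $$\mathbb{P}(X_t=v\mid X_{t-1}=w_{t-1},\dots,X_{t-\ell}=w_{t-\ell})=\frac{1}{\deg(w_{t-1})}.$$ (On $K_n$, this means conditional probability $\frac1{n-1}$ for every $v\ne w_{t-1}$.) Let $m\ge1$ and let $R$ be a partial order on $[m]$, with strict order relation denoted $<_R$. A permutation $\sigma\in S_m$ respects $R$ if $i<_R j$ implies $\sigma(i)<\sigma(j)$ for all $i,j\in[m]$. An $R$ partially ordered avoidance coupling ($R$ POSAC)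 of $m$ walks on a graph $G$ with vertex set $[n]$ is a sequence $(U_t)_{t\in\mathbb{Z}}$ of random maps $U_t:[m]\to[n]$, such that there exists a sequence $(\sigma_t)_{t\in\mathbb{Z}}$ of random permutations in $S_m$, defined on the same probability space as $(U_t)_{t\in\mathbb{Z}}$ and each respecting $R$, for which: (1) for every $i\in[m]$, $(U_t(i))_{t\in\mathbb{Z}}$ is a simple random walk on $G$; (2) for every $t\in\mathbb{Z}$ and all distinct $i,j\in[m]$, $\mathbb{P}(U_t(i)=U_t(j))=0$ and $\mathbb{P}\big(U_t(i)=U_{t-1}(j)\text{ and }\sigma_t(i)<\sigma_t(j)\big)=0$. Here $\sigma_t(i)$ is the position of walker $i$ in the order in which the walkers move in round $t$. The permutations $\sigma_t$ may depend on the walks in an arbitrary way, and no independence between different walks is required. The existence of an $R$ POSAC means that some probability space carries such sequences. *)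

theory Defs
  imports "HOL-Probability.Probability" "HOL-Combinatorics.Permutations"
begin

text \<open>A graph with vertex set \<open>{1..n}\<close> is given by its symmetric adjacency relation
  \<open>E \<subseteq> {1..n} \<times> {1..n}\<close>, so that \<open>E `` {v}\<close> is the set of neighbours of \<open>v\<close>.\<close>

definition complete_adjacency :: "nat \<Rightarrow> nat rel" where
  "complete_adjacency n = {(u, v). u \<in> {1..n} \<and> v \<in> {1..n} \<and> u \<noteq> v}"

text \<open>A history of length \<open>l\<close> before time \<open>t\<close> is a function \<open>w\<close> of which only the values
  at the times \<open>t - l, \<dots>, t - 1\<close> are used.\<close>

definition simple_random_walk ::
  "nat \<Rightarrow> nat rel \<Rightarrow> 'a measure \<Rightarrow> (int \<Rightarrow> 'a \<Rightarrow> nat) \<Rightarrow> bool" where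
  "simple_random_walk n E M X \<longleftrightarrow>
     (\<forall>t. X t \<in> M \<rightarrow>\<^sub>M count_space {1..n}) \<and>
     (\<forall>(t::int) (l::nat) (w::int \<Rightarrow> nat).
        l \<ge> 1 \<longrightarrow> (\<forall>s\<in>{t - int l..t - 1}. w s \<in> {1..n}) \<longrightarrow>
        \<P>(\<omega> in M. \<forall>s\<in>{t - int l..t - 1}. X s \<omega> = w s) > 0 \<longrightarrow>
        (\<forall>v\<in>E `` {w (t - 1)}.
           \<P>(\<omega> in M. X t \<omega> = v \<bar> \<forall>s\<in>{t - int l..t - 1}. X s \<omega> = w s)
             = 1 / real (card (E `` {w (t - 1)}))))"

text \<open>\<open>R\<close> is the reflexive relation, as in \<open>partial_order_on\<close>; its strict part is \<open>R\<close> minus the diagonal.\<close>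

definition respects_order :: "nat \<Rightarrow> nat rel \<Rightarrow> (nat \<Rightarrow> nat) \<Rightarrow> bool" where
  "respects_order m R p \<longleftrightarrow>
     (\<forall>i\<in>{1..m}. \<forall>j\<in>{1..m}. (i, j) \<in> R \<and> i \<noteq> j \<longrightarrow> p i < p j)"

text \<open>Random maps \<open>{1..m} \<rightarrow> {1..n}\<close> and random permutations of \<open>{1..m}\<close> are measurable maps
  into the finite discrete spaces of such maps (extended by \<open>undefined\<close> and by the identity
  outside \<open>{1..m}\<close>, respectively).\<close>

definition posac ::
  "nat \<Rightarrow> nat rel \<Rightarrow> nat \<Rightarrow> nat rel \<Rightarrow> 'a measure \<Rightarrow> (int \<Rightarrow> 'a \<Rightarrow> nat \<Rightarrow> nat) \<Rightarrow> bool" where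
  "posac n E m R M U \<longleftrightarrow>
     prob_space M \<and>
     (\<forall>t. U t \<in> M \<rightarrow>\<^sub>M count_space ({1..m} \<rightarrow>\<^sub>E {1..n})) \<and>
     (\<exists>\<sigma> :: int \<Rightarrow> 'a \<Rightarrow> nat \<Rightarrow> nat.
        (\<forall>t. \<sigma> t \<in> M \<rightarrow>\<^sub>M count_space {p. p permutes {1..m}}) \<and>
        (\<forall>t. \<forall>\<omega>\<in>space M. respects_order m R (\<sigma> t \<omega>)) \<and>
        (\<forall>i\<in>{1..m}. simple_random_walk n E M (\<lambda>t \<omega>. U t \<omega> i)) \<and>
        (\<forall>t. \<forall>i\<in>{1..m}. \<forall>j\<in>{1..m}. i \<noteq> j \<longrightarrow>
           \<P>(\<omega> in M. U t \<omega> i = U t \<omega> j) = 0 \<and>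
           \<P>(\<omega> in M. U t \<omega> i = U (t - 1) \<omega> j \<and> \<sigma> t \<omega> i < \<sigma> t \<omega> j) = 0))"

text \<open>The sample space of all trajectories of pairs (positions, order of moves). Existence of
  a coupling on a probability space over any type implies existence on a probability space
  over this type, as shown next; so quantifying over measures on this type expresses
  existence on some probability space.\<close>

type_synonym trajectory = "int \<Rightarrow> (nat \<Rightarrow> nat) \<times> (nat \<Rightarrow> nat)"

lemma posac_imp_posac_trajectory:
  fixes M :: "'a measure"
  assumes "posac n E m R M U"
  shows "\<exists>(M' :: trajectory measure) U'. posac n E m R M' U'"
proof -
  from assms obtain s where M: "prob_space M"
    and U[measurable]: "\<And>t. U t \<in> M \<rightarrow>\<^sub>M count_space ({1..m} \<rightarrow>\<^sub>E {1..n})"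
    and s[measurable]: "\<And>t. s t \<in> M \<rightarrow>\<^sub>M count_space {p. p permutes {1..m}}"
    and resp: "\<And>t \<omega>. \<omega> \<in> space M \<Longrightarrow> respects_order m R (s t \<omega>)"
    and walk: "\<And>i. i \<in> {1..m} \<Longrightarrow> simple_random_walk n E M (\<lambda>t \<omega>. U t \<omega> i)"
    and avoid: "\<And>t i j. i \<in> {1..m} \<Longrightarrow> j \<in> {1..m} \<Longrightarrow> i \<noteq> j \<Longrightarrow>
           \<P>(\<omega> in M. U t \<omega> i = U t \<omega> j) = 0 \<and>
           \<P>(\<omega> in M. U t \<omega> i = U (t - 1) \<omega> j \<and> s t \<omega> i < s t \<omega> j) = 0"
    unfolding posac_def by blast
  let ?A = "{1..m} \<rightarrow>\<^sub>E {1..n}"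
  let ?B = "{p. p permutes {1..m} \<and> respects_order m R p}"
  define S where "S = Pi\<^sub>M (UNIV :: int set) (\<lambda>_. count_space ?A \<Otimes>\<^sub>M count_space ?B)"
  define f where "f \<omega> = (\<lambda>t. (U t \<omega>, s t \<omega>))" for \<omega>
  have sB[measurable]: "s t \<in> M \<rightarrow>\<^sub>M count_space ?B" for t
  proof -
    have "finite ?B"
      by (rule finite_subset[OF _ finite_permutations[of "{1..m}"]]) auto
    moreover have "s t \<in> space M \<rightarrow> ?B"
      using resp measurable_space[OF s] by auto
    moreover have "s t -` {p} \<inter> space M \<in> sets M" if "p \<in> ?B" for p
      using measurable_sets[OF s, of "{p}" t] that by auto
    ultimately show ?thesis
      by (subst measurable_count_space_eq2) auto
  qed
  have f[measurable]: "f \<in> M \<rightarrow>\<^sub>M S"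
    unfolding S_def f_def
  proof (rule measurable_PiM_single')
    show P: "(\<lambda>\<omega>. (U t \<omega>, s t \<omega>)) \<in> M \<rightarrow>\<^sub>M count_space ?A \<Otimes>\<^sub>M count_space ?B" for t
      by (rule measurable_Pair[OF U sB])
    show "(\<lambda>\<omega> t. (U t \<omega>, s t \<omega>))
        \<in> space M \<rightarrow> (\<Pi>\<^sub>E t\<in>UNIV. space (count_space ?A \<Otimes>\<^sub>M count_space ?B))"
      using measurable_space[OF P] by (simp add: Pi_def PiE_def)
  qed
  define N where "N = distr M S f"
  define V where "V t x = fst (x t)" for t :: int and x :: trajectory
  define r where "r t x = snd (x t)" for t :: int and x :: trajectory
  have V: "V t \<in> S \<rightarrow>\<^sub>M count_space ?A" for t
    unfolding V_def S_def by measurable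
  have r: "r t \<in> S \<rightarrow>\<^sub>M count_space ?B" for t
    unfolding r_def S_def by measurable
  have r': "r t \<in> S \<rightarrow>\<^sub>M count_space {p. p permutes {1..m}}" for t
    using measurable_comp[OF r, of id "count_space {p. p permutes {1..m}}" t] by (simp add: subset_eq)
  have Vi: "(\<lambda>x. V t x i) \<in> S \<rightarrow>\<^sub>M count_space {1..n}" if "i \<in> {1..m}" for t i
    by (rule measurable_compose[OF V]) (use that in auto)
  have Vi'[measurable]: "(\<lambda>x. V t x i) \<in> S \<rightarrow>\<^sub>M count_space UNIV" for t i
    by (rule measurable_compose[OF V]) auto
  have ri'[measurable]: "(\<lambda>x. r t x i) \<in> S \<rightarrow>\<^sub>M count_space UNIV" for t i
    by (rule measurable_compose[OF r]) auto
  have lt[measurable]: "Measurable.pred S (\<lambda>x. r t x i < r t x j)" for t i j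
    by (rule measurable_compose[OF r]) auto
  have Vf: "V t (f \<omega>) = U t \<omega>" and rf: "r t (f \<omega>) = s t \<omega>" for t \<omega>
    by (auto simp: V_def r_def f_def)
  have tr: "\<P>(x in N. P x) = \<P>(\<omega> in M. P (f \<omega>))" if P: "Measurable.pred S P" for P
  proof -
    have "{x \<in> space S. P x} \<in> sets S" using P by simp
    then have "measure N {x \<in> space S. P x} = measure M (f -` {x \<in> space S. P x} \<inter> space M)"
      unfolding N_def by (intro measure_distr f)
    also have "f -` {x \<in> space S. P x} \<inter> space M = {\<omega> \<in> space M. P (f \<omega>)}"
      using measurable_space[OF f] by auto
    finally show ?thesis by (simp add: N_def)
  qed
  have hist: "Measurable.pred S (\<lambda>x. \<forall>s\<in>{a..b}. V s x i = w s)" for a b :: int and i and w :: "int \<Rightarrow> nat"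
    by measurable
  have "simple_random_walk n E N (\<lambda>t x. V t x i)" if i: "i \<in> {1..m}" for i
    unfolding simple_random_walk_def
  proof (intro conjI allI impI ballI)
    show "(\<lambda>x. V t x i) \<in> N \<rightarrow>\<^sub>M count_space {1..n}" for t
      using Vi[OF i] by (simp add: N_def)
  next
    fix t :: int and l :: nat and w :: "int \<Rightarrow> nat" and v
    assume *: "1 \<le> l" "\<forall>s\<in>{t - int l..t - 1}. w s \<in> {1..n}"
      "0 < \<P>(x in N. \<forall>s\<in>{t - int l..t - 1}. V s x i = w s)" "v \<in> E `` {w (t - 1)}"
    have "\<P>(x in N. V t x i = v \<bar> \<forall>s\<in>{t - int l..t - 1}. V s x i = w s)
      = \<P>(\<omega> in M. U t \<omega> i = v \<bar> \<forall>s\<in>{t - int l..t - 1}. U s \<omega> i = w s)"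
      unfolding cond_prob_def by (subst (1 2) tr) (simp_all only: Vf, measurable)
    also have "\<dots> = 1 / real (card (E `` {w (t - 1)}))"
      using walk[OF i] * unfolding simple_random_walk_def tr[OF hist] Vf by blast
    finally show "\<P>(x in N. V t x i = v \<bar> \<forall>s\<in>{t - int l..t - 1}. V s x i = w s) = \<dots>" .
  qed
  moreover have "\<P>(x in N. V t x i = V t x j) = 0 \<and>
      \<P>(x in N. V t x i = V (t - 1) x j \<and> r t x i < r t x j) = 0"
    if "i \<in> {1..m}" "j \<in> {1..m}" "i \<noteq> j" for t i j
  proof -
    have "Measurable.pred S (\<lambda>x. V t x i = V t x j)"
      and "Measurable.pred S (\<lambda>x. V t x i = V (t - 1) x j \<and> r t x i < r t x j)"
      by measurable
    then show ?thesis
      using avoid[OF that, of t] by (simp add: tr Vf rf)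
  qed
  moreover have "prob_space N"
    unfolding N_def by (intro prob_space.prob_space_distr M f)
  moreover have "V t \<in> N \<rightarrow>\<^sub>M count_space ?A" "r t \<in> N \<rightarrow>\<^sub>M count_space {p. p permutes {1..m}}" for t
    using V r' by (simp_all add: N_def)
  moreover have "respects_order m R (r t x)" if "x \<in> space N" for t x
    using measurable_space[OF r, of x t] that by (simp add: N_def)
  ultimately have "posac n E m R N V"
    unfolding posac_def by blast
  then show ?thesis by blast
qed

end

theory Submission
  imports Defs
begin

text \<open>Let \<open>X\<close> be the new walker. At every time the old walkers see the \<open>N - 1\<close> vertices not occupied
  by \<open>X\<close> as a copy of the complete graph on \<open>N - 1\<close> vertices, through a random bijection, and play the
  given coupling there. Together with \<open>N \<mapsto> X\<close> the bijection is a permutation \<open>\<phi>\<^sub>t\<close> of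
  \<open>{1..N}\<close>, the frame. In round \<open>t\<close> a label \<open>a\<^sub>t\<close>, uniform in \<open>{1..N - 1}\<close> and independent
  of everything else, is drawn, \<open>X\<close> jumps to the vertex named \<open>a\<^sub>t\<close>, and the vertex it leaves inherits
  that name: \<open>\<phi>\<^sub>t = \<phi>\<^sub>t\<^sub>-\<^sub>1 \<circ> (N a\<^sub>t)\<close>. An old walker that
  steps from \<open>u\<close> to \<open>v\<close> in the given coupling thus moves from \<open>\<phi>\<^sub>t\<^sub>-\<^sub>1(u)\<close> to
  \<open>\<phi>\<^sub>t\<^sub>-\<^sub>1(v)\<close> if \<open>v \<noteq> a\<^sub>t\<close>, and to the vertex left by \<open>X\<close> otherwise.

  \<^emph>\<open>Each walk is simple.\<close> Given the past, \<open>v\<close> is uniform among the \<open>N - 2\<close> labels other than \<open>u\<close>,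
  and \<open>a\<^sub>t\<close> equals it with probability \<open>1 / (N - 1)\<close>. So the vertex left by \<open>X\<close> is reached with
  probability \<open>1 / (N - 1)\<close>, and each of the other \<open>N - 2\<close> possible vertices with probability
  \<open>(1 / (N - 2)) \<cdot> ((N - 2) / (N - 1))\<close>, which is the same. The walker \<open>X\<close> itself moves to a uniform
  vertex because \<open>a\<^sub>t\<close> is uniform. Both cases are captured by the notion \<open>star_compatible\<close> and treated
  together in \<open>simple_random_walk_moving_frame\<close>. Time being two-sided, the frames are anchored at time
  \<open>0\<close> by a uniformly random permutation; then, for every \<open>r\<close>, the frame at time \<open>r\<close> is uniform and
  independent of all labels, so that the past of any time \<open>t\<close> can be described without \<open>a\<^sub>t\<close>.

  \<^emph>\<open>Nobody is run into.\<close> The only new conflicts are between \<open>X\<close> and the walker \<open>j\<close> that stood at the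
  label \<open>a\<^sub>t\<close>, who has to move before \<open>X\<close>, and the walker \<open>i\<close> that steps to the label \<open>a\<^sub>t\<close>,
  who has to move after \<open>X\<close>. In the given coupling \<open>i\<close> takes the place of \<open>j\<close>, so \<open>j\<close> moves before \<open>i\<close>
  there, and there is room to insert \<open>X\<close> directly after \<open>j\<close>. The relative order of the old walkers
  stays as it was, hence still respects the partial order.\<close>

section \<open>The moving frame\<close>

text \<open>If \<open>p\<close> is the frame at time \<open>0\<close>, then \<open>p \<circ> frame N a t\<close> is the one at time \<open>t\<close>. The recursion
  \<open>frame_step\<close> determines it forwards and, a transposition being its own inverse, backwards.\<close>

primrec frame_forward :: "nat \<Rightarrow> (int \<Rightarrow> nat) \<Rightarrow> nat \<Rightarrow> nat \<Rightarrow> nat" where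
  "frame_forward N a 0 = id"
| "frame_forward N a (Suc n) = frame_forward N a n \<circ> Transposition.transpose N (a (int n + 1))"

primrec frame_backward :: "nat \<Rightarrow> (int \<Rightarrow> nat) \<Rightarrow> nat \<Rightarrow> nat \<Rightarrow> nat" where
  "frame_backward N a 0 = id"
| "frame_backward N a (Suc n) = frame_backward N a n \<circ> Transposition.transpose N (a (- int n))"

definition frame :: "nat \<Rightarrow> (int \<Rightarrow> nat) \<Rightarrow> int \<Rightarrow> nat \<Rightarrow> nat" where
  "frame N a t = (if 0 \<le> t then frame_forward N a (nat t) else frame_backward N a (nat (- t)))"

lemma frame_step: "frame N a t = frame N a (t - 1) \<circ> Transposition.transpose N (a t)"
proof (cases "t > 0")
  case True
  then obtain n where n: "t = int (Suc n)" by (metis pos_int_cases gr0_conv_Suc)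
  then have "frame N a t = frame_forward N a (Suc n)" "frame N a (t - 1) = frame_forward N a n"
    by (simp_all add: frame_def nat_add_distrib del: frame_forward.simps)
  then show ?thesis using n by (simp add: add.commute)
next
  case False
  define n where "n = nat (- t)"
  have t: "t = - int n" using False by (simp add: n_def)
  have "frame N a t = frame_backward N a n"
    by (cases "n = 0") (simp_all add: frame_def t)
  moreover have "nat (1 + int n) = Suc n" by simp
  then have "frame N a (t - 1) = frame_backward N a (Suc n)"
    by (simp add: frame_def t del: frame_backward.simps)
  ultimately show ?thesis by (simp add: t comp_assoc)
qed

lemma permutes_frame:
  assumes a: "\<And>s. a s \<in> {1..N}"
  shows "frame N a t permutes {1..N}"
proof -
  have "1 \<le> N" using a[of 0] by simp
  then have tr: "Transposition.transpose N (a s) permutes {1..N}" for s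
    using a by (intro permutes_swap_id) auto
  have "frame_forward N a n permutes {1..N}" "frame_backward N a n permutes {1..N}" for n
    by (induction n) (simp_all add: permutes_compose tr permutes_id del: One_nat_def)
  then show ?thesis by (simp add: frame_def)
qed

text \<open>The frame at time \<open>s\<close> as seen from the frame at time \<open>r\<close>.\<close>

definition relative_frame :: "nat \<Rightarrow> (int \<Rightarrow> nat) \<Rightarrow> int \<Rightarrow> int \<Rightarrow> nat \<Rightarrow> nat" where
  "relative_frame N a r s = inv (frame N a r) \<circ> frame N a s"

lemma permutes_relative_frame:
  assumes "\<And>s. a s \<in> {1..N}"
  shows "relative_frame N a r s permutes {1..N}"
  unfolding relative_frame_def using assms
  by (intro permutes_compose permutes_inv permutes_frame) auto

lemma frame_comp_relative_frame:
  assumes "\<And>s. a s \<in> {1..N}"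
  shows "frame N a r \<circ> relative_frame N a r s = frame N a s"
  using permutes_inv_o(1)[OF permutes_frame[of a N r]] assms
  by (simp add: relative_frame_def comp_assoc[symmetric])

text \<open>Going back from time \<open>r\<close> to time \<open>s \<le> r\<close> undoes the transpositions of the rounds
  \<open>s + 1, \<dots>, r\<close> only. In particular, nothing seen from time \<open>t - 1\<close> in the past of \<open>t\<close> depends on the
  label of round \<open>t\<close>, although for \<open>t \<le> 0\<close> the anchored frames themselves do.\<close>

lemma relative_frame_past:
  assumes a: "\<And>s. a s \<in> {1..N}" and b: "\<And>s. b s \<in> {1..N}"
    and eq: "\<And>s. s \<le> r \<Longrightarrow> a s = b s" and "s \<le> r"
  shows "relative_frame N a r s = relative_frame N b r s"
  using \<open>s \<le> r\<close>
proof (induction s rule: int_le_induct)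
  case base
  then show ?case
    using a b by (simp add: relative_frame_def permutes_inv_o(2)[OF permutes_frame])
next
  case (step s)
  have unroll: "relative_frame N c r (s - 1)
      = relative_frame N c r s \<circ> Transposition.transpose N (c s)" for c
    using frame_step[of N c s] by (simp add: relative_frame_def comp_assoc)
  show ?case by (simp add: unroll step eq)
qed

lemma relative_frame_next:
  assumes "\<And>s. a s \<in> {1..N}"
  shows "relative_frame N a (t - 1) t = Transposition.transpose N (a t)"
  using permutes_inv_o(2)[OF permutes_frame[of a N "t - 1"]] assms
  by (subst relative_frame_def, subst frame_step) (simp add: comp_assoc[symmetric])

section \<open>The randomised frame\<close>

definition label_space :: "nat \<Rightarrow> (int \<Rightarrow> nat) measure" where
  "label_space N = Pi\<^sub>M UNIV (\<lambda>_. uniform_count_measure {1..N - 1})"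

text \<open>A point \<open>(a, p, x)\<close> consists of the labels, the frame at time \<open>0\<close>, and a point of the sample
  space of the given coupling; the three are independent.\<close>

definition frame_space :: "nat \<Rightarrow> 'a measure \<Rightarrow> ((int \<Rightarrow> nat) \<times> (nat \<Rightarrow> nat) \<times> 'a) measure" where
  "frame_space N M =
     label_space N \<Otimes>\<^sub>M (uniform_count_measure {p. p permutes {1..N}} \<Otimes>\<^sub>M M)"

lemma prob_space_label_space:
  assumes "2 \<le> N"
  shows "prob_space (label_space N)"
  unfolding label_space_def using assms
  by (intro prob_space_PiM prob_space_uniform_count_measure) auto

lemma prob_space_uniform_permutations:
  "prob_space (uniform_count_measure {p. p permutes {1..N::nat}})"
  using permutes_id[of "{1..N}"]
  by (intro prob_space_uniform_count_measure finite_permutations) blast+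

lemma prob_space_frame_space:
  assumes "2 \<le> N" "prob_space M"
  shows "prob_space (frame_space N M)"
  unfolding frame_space_def using assms
  by (intro prob_space_pair prob_space_label_space prob_space_uniform_permutations)

lemma space_label_space: "a \<in> space (label_space N) \<longleftrightarrow> (\<forall>s. a s \<in> {1..N - 1})"
  by (auto simp: label_space_def space_PiM space_uniform_count_measure PiE_def Pi_def)

lemma label_in_range:
  assumes "a \<in> space (label_space N)"
  shows "a s \<in> {1..N}"
  using assms[unfolded space_label_space, rule_format, of s] by auto

lemma space_frame_space:
  "(a, p, x) \<in> space (frame_space N M) \<longleftrightarrow>
     a \<in> space (label_space N) \<and> p permutes {1..N} \<and> x \<in> space M"
  by (auto simp: frame_space_def space_pair_measure space_uniform_count_measure)

text \<open>Random maps and random permutations take values in finite sets, but the type \<open>nat \<Rightarrow> nat\<close> of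
  these values is uncountable, so the countability has to be assumed of the sets.\<close>

lemma measurable_combine_discrete:
  assumes f: "f \<in> X \<rightarrow>\<^sub>M count_space S" and g: "g \<in> X \<rightarrow>\<^sub>M count_space T"
    and "countable S" "countable T" and h: "\<And>s t. s \<in> S \<Longrightarrow> t \<in> T \<Longrightarrow> h s t \<in> R"
  shows "(\<lambda>x. h (f x) (g x)) \<in> X \<rightarrow>\<^sub>M count_space R"
proof -
  have "(\<lambda>x. (f x, g x)) \<in> X \<rightarrow>\<^sub>M count_space (S \<times> T)"
    using measurable_Pair[OF f g] pair_measure_countable[OF assms(3,4)] by simp
  moreover have "(\<lambda>(s, t). h s t) \<in> count_space (S \<times> T) \<rightarrow>\<^sub>M count_space R"
    using h by auto
  ultimately show ?thesis
    using measurable_compose[of "\<lambda>x. (f x, g x)" X "count_space (S \<times> T)" "\<lambda>(s, t). h s t"] by simp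
qed

lemma countable_permutations: "finite A \<Longrightarrow> countable {p. p permutes A}"
  by (intro countable_finite finite_permutations)

lemma measurable_label: "(\<lambda>a. a s) \<in> label_space N \<rightarrow>\<^sub>M count_space {1..N - 1}"
proof -
  have "(\<lambda>a. a s) \<in> label_space N \<rightarrow>\<^sub>M uniform_count_measure {1..N - 1}"
    unfolding label_space_def by (rule measurable_component_singleton) simp
  then show ?thesis
    by (simp add: measurable_cong_sets[OF refl sets_uniform_count_measure_count_space])
qed

lemma measurable_frame:
  assumes "2 \<le> N"
  shows "(\<lambda>a. frame N a t) \<in> label_space N \<rightarrow>\<^sub>M count_space {p. p permutes {1..N}}"
proof -
  have step: "(\<lambda>a. f a \<circ> Transposition.transpose N (a s)) \<in> label_space N \<rightarrow>\<^sub>M count_space {p. p permutes {1..N}}"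
    if "f \<in> label_space N \<rightarrow>\<^sub>M count_space {p. p permutes {1..N}}" for f s
    using assms
    by (intro measurable_combine_discrete[OF that measurable_label[of s N], of "\<lambda>p x. p \<circ> Transposition.transpose N x"])
      (auto intro!: permutes_compose permutes_swap_id countable_permutations)
  have "(\<lambda>a. frame_forward N a n) \<in> label_space N \<rightarrow>\<^sub>M count_space {p. p permutes {1..N}}"
    and "(\<lambda>a. frame_backward N a n) \<in> label_space N \<rightarrow>\<^sub>M count_space {p. p permutes {1..N}}" for n
    by (induction n) (use permutes_id[of "{1..N}"] in \<open>auto intro!: step simp del: One_nat_def\<close>)
  then show ?thesis by (simp add: frame_def)
qed

lemma measurable_frame_space_projections:
  "(\<lambda>(a, p, x). a) \<in> frame_space N M \<rightarrow>\<^sub>M label_space N"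
  "(\<lambda>(a, p, x). p) \<in> frame_space N M \<rightarrow>\<^sub>M count_space {p. p permutes {1..N}}"
  "(\<lambda>(a, p, x). x) \<in> frame_space N M \<rightarrow>\<^sub>M M"
proof -
  have *: "(\<lambda>z. fst (snd z)) \<in> frame_space N M \<rightarrow>\<^sub>M uniform_count_measure {p. p permutes {1..N}}"
    unfolding frame_space_def by measurable
  show "(\<lambda>(a, p, x). a) \<in> frame_space N M \<rightarrow>\<^sub>M label_space N"
    "(\<lambda>(a, p, x). x) \<in> frame_space N M \<rightarrow>\<^sub>M M"
    unfolding frame_space_def by measurable
  show "(\<lambda>(a, p, x). p) \<in> frame_space N M \<rightarrow>\<^sub>M count_space {p. p permutes {1..N}}"
    using * by (simp add: case_prod_beta' measurable_cong_sets[OF refl sets_uniform_count_measure_count_space])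
qed

lemma measurable_random_frame:
  assumes "2 \<le> N"
  shows "(\<lambda>(a, p, x). p \<circ> frame N a t) \<in> frame_space N M \<rightarrow>\<^sub>M count_space {p. p permutes {1..N}}"
proof -
  have "(\<lambda>z. (\<lambda>p q. p \<circ> q) (case z of (a, p, x) \<Rightarrow> p) (frame N (case z of (a, p, x) \<Rightarrow> a) t))
      \<in> frame_space N M \<rightarrow>\<^sub>M count_space {p. p permutes {1..N}}"
    by (rule measurable_combine_discrete[OF measurable_frame_space_projections(2)
          measurable_compose[OF measurable_frame_space_projections(1) measurable_frame[OF assms]]])
      (auto intro!: permutes_compose countable_permutations simp del: o_apply)
  then show ?thesis by (simp add: case_prod_beta')
qed

text \<open>Fubini, with the integral over the uniform permutation written as a finite sum so that it can
  be reindexed.\<close>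

lemma
  assumes M: "prob_space M" and "2 \<le> N"
    and Q: "{z \<in> space (frame_space N M). Q z} \<in> sets (frame_space N M)"
  defines "w \<equiv> \<lambda>a. \<Sum>p | p permutes {1..N}. ennreal (1 / fact N) * emeasure M {x \<in> space M. Q (a, p, x)}"
  shows emeasure_frame_space:
      "emeasure (frame_space N M) {z \<in> space (frame_space N M). Q z} = (\<integral>\<^sup>+a. w a \<partial>label_space N)"
    and borel_measurable_frame_section: "w \<in> borel_measurable (label_space N)"
proof -
  define P where "P = uniform_count_measure {p. p permutes {1..N}}"
  interpret M: prob_space M by fact
  interpret P: prob_space P
    unfolding P_def by (rule prob_space_uniform_permutations)
  interpret PM: prob_space "P \<Otimes>\<^sub>M M"
    by (intro prob_space_pair M P.prob_space_axioms)
  let ?E = "{z \<in> space (frame_space N M). Q z}"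
  have E: "?E \<in> sets (label_space N \<Otimes>\<^sub>M (P \<Otimes>\<^sub>M M))"
    using Q by (simp add: frame_space_def P_def)
  have w: "w a = emeasure (P \<Otimes>\<^sub>M M) (Pair a -` ?E)" if a: "a \<in> space (label_space N)" for a
  proof -
    have "emeasure (P \<Otimes>\<^sub>M M) (Pair a -` ?E) = (\<integral>\<^sup>+p. emeasure M (Pair p -` Pair a -` ?E) \<partial>P)"
      by (rule M.emeasure_pair_measure_alt) (rule sets_Pair1[OF E])
    also have "\<dots> = (\<Sum>p | p permutes {1..N}. ennreal (1 / fact N) * emeasure M (Pair p -` Pair a -` ?E))"
      by (simp add: P_def uniform_count_measure_def nn_integral_point_measure_finite
          finite_permutations card_permutations)
    also have "\<dots> = w a"
      unfolding w_def using a
      by (intro sum.cong refl arg_cong2[where f="(*)"] arg_cong2[where f=emeasure])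
        (auto simp: space_frame_space)
    finally show ?thesis by simp
  qed
  have "emeasure (frame_space N M) ?E = (\<integral>\<^sup>+a. emeasure (P \<Otimes>\<^sub>M M) (Pair a -` ?E) \<partial>label_space N)"
    using PM.emeasure_pair_measure_alt[OF E] by (simp add: frame_space_def P_def)
  then show "emeasure (frame_space N M) ?E = (\<integral>\<^sup>+a. w a \<partial>label_space N)"
    by (simp add: w cong: nn_integral_cong)
  show "w \<in> borel_measurable (label_space N)"
    using PM.measurable_emeasure_Pair[OF E] by (simp add: w cong: measurable_cong)
qed

text \<open>The labels are independent, so replacing one of them by a fresh uniform label does not
  change their joint distribution.\<close>

lemma nn_integral_resample_label:
  assumes "2 \<le> N" and f: "f \<in> borel_measurable (label_space N)"
  shows "(\<integral>\<^sup>+a. f a \<partial>label_space N) =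
    (\<integral>\<^sup>+a. (\<Sum>x\<in>{1..N - 1}. ennreal (1 / (real N - 1)) * f (a(t := x))) \<partial>label_space N)"
proof -
  define D where "D = uniform_count_measure {1..N - 1}"
  have D: "prob_space D"
    unfolding D_def using assms by (intro prob_space_uniform_count_measure) auto
  interpret D: prob_space D by fact
  interpret L: prob_space "label_space N"
    using assms(1) by (rule prob_space_label_space)
  interpret DL: pair_sigma_finite D "label_space N" ..
  have upd[measurable]: "(\<lambda>(x, a). a(t := x)) \<in> D \<Otimes>\<^sub>M label_space N \<rightarrow>\<^sub>M label_space N"
    unfolding label_space_def D_def case_prod_beta'
    by (rule measurable_fun_upd[where J = UNIV]) (simp, measurable)
  have "label_space N = distr (D \<Otimes>\<^sub>M label_space N) (label_space N) (\<lambda>(x, a). a(t := x))"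
    using distr_pair_PiM_eq_PiM[of UNIV "\<lambda>_. D" t] D by (simp add: label_space_def D_def)
  then have "(\<integral>\<^sup>+a. f a \<partial>label_space N) =
      (\<integral>\<^sup>+a. f a \<partial>distr (D \<Otimes>\<^sub>M label_space N) (label_space N) (\<lambda>(x, a). a(t := x)))"
    by simp
  also have "\<dots> = (\<integral>\<^sup>+z. f (case z of (x, a) \<Rightarrow> a(t := x)) \<partial>(D \<Otimes>\<^sub>M label_space N))"
    using f by (intro nn_integral_distr[OF upd]) simp
  also have "\<dots> = (\<integral>\<^sup>+a. (\<integral>\<^sup>+x. f (a(t := x)) \<partial>D) \<partial>label_space N)"
    using DL.nn_integral_snd[OF measurable_compose[OF upd f]] by simp
  also have "\<dots> = (\<integral>\<^sup>+a. (\<Sum>x\<in>{1..N - 1}. ennreal (1 / (real N - 1)) * f (a(t := x))) \<partial>label_space N)"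
    using assms(1)
    by (simp add: D_def uniform_count_measure_def nn_integral_point_measure_finite of_nat_diff)
  finally show ?thesis .
qed

section \<open>Walks that the moving frame turns into simple random walks\<close>

text \<open>Given the past, the image of \<open>u t\<close> under the transposition \<open>(N x)\<close>, with an independent uniform
  \<open>x \<in> {1..N - 1}\<close>, is uniform on the values other than \<open>u (t - 1)\<close>. To say so without dividing,
  both sides are multiplied by \<open>N - 1\<close> and by the probability of the history \<open>y\<close>, which may then be any
  function.\<close>

definition star_compatible :: "nat \<Rightarrow> 'a measure \<Rightarrow> (int \<Rightarrow> 'a \<Rightarrow> nat) \<Rightarrow> bool" where
  "star_compatible N M u \<longleftrightarrow>
     (\<forall>t. u t \<in> M \<rightarrow>\<^sub>M count_space {1..N}) \<and>
     (\<forall>(t::int) (l::nat) y. \<forall>z\<in>{1..N}. l \<ge> 1 \<longrightarrow> z \<noteq> y (t - 1) \<longrightarrow>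
        (\<Sum>x\<in>{1..N - 1}. \<P>(\<omega> in M. (\<forall>s\<in>{t - int l..t - 1}. u s \<omega> = y s) \<and>
             u t \<omega> = Transposition.transpose N x z))
          = \<P>(\<omega> in M. \<forall>s\<in>{t - int l..t - 1}. u s \<omega> = y s))"

lemma complete_adjacency_neighbours:
  assumes "v \<in> {1..n}"
  shows "complete_adjacency n `` {v} = {1..n} - {v}"
    and "card (complete_adjacency n `` {v}) = n - 1"
proof -
  show "complete_adjacency n `` {v} = {1..n} - {v}"
    using assms by (auto simp: complete_adjacency_def)
  then show "card (complete_adjacency n `` {v}) = n - 1"
    using assms by simp
qed

lemma measurable_count_space_UNIV:
  assumes "f \<in> M \<rightarrow>\<^sub>M count_space A"
  shows "f \<in> M \<rightarrow>\<^sub>M count_space UNIV"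
  using measurable_compose[OF assms, of "\<lambda>x. x" "count_space UNIV"] by simp

lemma (in prob_space) sum_prob_values:
  assumes X: "X \<in> M \<rightarrow>\<^sub>M count_space S" and "finite S" and Q: "Measurable.pred M Q"
  shows "(\<Sum>x\<in>S. \<P>(\<omega> in M. Q \<omega> \<and> X \<omega> = x)) = \<P>(\<omega> in M. Q \<omega>)"
proof -
  note [measurable] = measurable_count_space_UNIV[OF X] Q
  have "\<P>(\<omega> in M. Q \<omega>) = prob (\<Union>x\<in>S. {\<omega> \<in> space M. Q \<omega> \<and> X \<omega> = x})"
    using measurable_space[OF X] by (intro arg_cong[where f=prob]) auto
  also have "\<dots> = (\<Sum>x\<in>S. \<P>(\<omega> in M. Q \<omega> \<and> X \<omega> = x))"
    using \<open>finite S\<close> by (intro finite_measure_finite_Union) (auto simp: disjoint_family_on_def)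
  finally show ?thesis by simp
qed

text \<open>For \<open>z = N\<close> the transposed points \<open>x\<close> run through all positions, so the sum is the law
  of total probability. For \<open>z < N\<close> the label \<open>x = z\<close> asks for the impossible position \<open>N\<close>, and the
  other \<open>N - 2\<close> labels all ask for \<open>z\<close>, which has conditional probability \<open>1 / (N - 2)\<close>.\<close>

lemma star_compatible_simple_random_walk:
  assumes M: "prob_space M" and "3 \<le> N"
    and walk: "simple_random_walk (N - 1) (complete_adjacency (N - 1)) M u"
  shows "star_compatible N M u"
  unfolding star_compatible_def
proof (intro conjI allI ballI impI)
  interpret prob_space M by fact
  have u: "u t \<in> M \<rightarrow>\<^sub>M count_space {1..N - 1}" for t
    using walk by (simp add: simple_random_walk_def)
  note [measurable] = measurable_count_space_UNIV[OF u]
  show "u t \<in> M \<rightarrow>\<^sub>M count_space {1..N}" for t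
    using measurable_compose[OF u, of "\<lambda>x. x" "count_space {1..N}" t] by (force simp: Pi_def)
  fix t :: int and l :: nat and y :: "int \<Rightarrow> nat" and z
  assume z: "z \<in> {1..N}" and l: "l \<ge> 1" and zy: "z \<noteq> y (t - 1)"
  let ?H = "\<lambda>\<omega>. \<forall>s\<in>{t - int l..t - 1}. u s \<omega> = y s"
  have H: "Measurable.pred M ?H" by measurable
  show "(\<Sum>x\<in>{1..N - 1}. \<P>(\<omega> in M. ?H \<omega> \<and> u t \<omega> = Transposition.transpose N x z)) = \<P>(\<omega> in M. ?H \<omega>)"
  proof (cases "z = N")
    case True
    then show ?thesis
      using sum_prob_values[OF u[of t] _ H] by simp
  next
    case False
    \<comment> \<open>the summand for \<open>x = z\<close>\<close>
    have far: "\<P>(\<omega> in M. ?H \<omega> \<and> u t \<omega> = N) = 0"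
    proof -
      have "{\<omega> \<in> space M. ?H \<omega> \<and> u t \<omega> = N} = {}"
        using measurable_space[OF u[of t]] \<open>3 \<le> N\<close> by force
      then show ?thesis by (simp only: measure_empty)
    qed
    \<comment> \<open>the summands for \<open>x \<noteq> z\<close>\<close>
    have one: "real (N - 2) * \<P>(\<omega> in M. ?H \<omega> \<and> u t \<omega> = z) = \<P>(\<omega> in M. ?H \<omega>)"
    proof (cases "\<P>(\<omega> in M. ?H \<omega>) > 0")
      case True
      have "{\<omega> \<in> space M. ?H \<omega>} \<noteq> {}"
        using True by (metis less_irrefl measure_empty)
      then obtain \<omega> where "\<omega> \<in> space M" "?H \<omega>" by blast
      then have y: "y s \<in> {1..N - 1}" if "s \<in> {t - int l..t - 1}" for s
        using measurable_space[OF u[of s], of \<omega>] that by auto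
      then have y1: "y (t - 1) \<in> {1..N - 1}" using l by simp
      have "z \<in> complete_adjacency (N - 1) `` {y (t - 1)}"
        unfolding complete_adjacency_neighbours(1)[OF y1] using z zy False by auto
      then have "\<P>(\<omega> in M. u t \<omega> = z \<bar> ?H \<omega>) = 1 / real (N - 1 - 1)"
        unfolding complete_adjacency_neighbours(2)[OF y1, symmetric]
        using walk[unfolded simple_random_walk_def, THEN conjunct2, rule_format, of l t y z] l y True
        by simp
      then show ?thesis
        using True \<open>3 \<le> N\<close> by (simp add: cond_prob_def conj_commute field_simps)
    next
      case False
      then have "\<P>(\<omega> in M. ?H \<omega>) = 0"
        using measure_nonneg[of M] by (simp add: antisym not_less)
      moreover have "\<P>(\<omega> in M. ?H \<omega> \<and> u t \<omega> = z) \<le> \<P>(\<omega> in M. ?H \<omega>)"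
        by (rule finite_measure_mono) (auto, measurable)
      ultimately show ?thesis
        using measure_nonneg[of M "{\<omega> \<in> space M. ?H \<omega> \<and> u t \<omega> = z}"] by simp
    qed
    have zin: "z \<in> {1..N - 1}" using z False by auto
    have "(\<Sum>x\<in>{1..N - 1}. \<P>(\<omega> in M. ?H \<omega> \<and> u t \<omega> = Transposition.transpose N x z))
        = (\<Sum>x\<in>{1..N - 1} - {z}. \<P>(\<omega> in M. ?H \<omega> \<and> u t \<omega> = z))"
      using far zin False
      by (subst sum.remove[of _ z])
        (auto intro!: sum.cong simp del: One_nat_def)
    also have "\<dots> = real (N - 2) * \<P>(\<omega> in M. ?H \<omega> \<and> u t \<omega> = z)"
      using zin by (simp add: card_Diff_singleton numeral_2_eq_2)
    also have "\<dots> = \<P>(\<omega> in M. ?H \<omega>)" by (rule one)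
    finally show ?thesis .
  qed
qed

text \<open>The new walker always has the label \<open>N\<close> in the moving frame.\<close>

lemma star_compatible_const:
  assumes "2 \<le> N"
  shows "star_compatible N M (\<lambda>_ _. N)"
  unfolding star_compatible_def
proof (intro conjI allI ballI impI)
  show "(\<lambda>_. N) \<in> M \<rightarrow>\<^sub>M count_space {1..N}"
    using assms by simp
  fix t :: int and l :: nat and y :: "int \<Rightarrow> nat" and z
  assume z: "z \<in> {1..N}" and l: "l \<ge> 1" and zy: "z \<noteq> y (t - 1)"
  let ?H = "\<forall>s\<in>{t - int l..t - 1}. N = y s"
  have "(\<Sum>x\<in>{1..N - 1}. \<P>(\<omega> in M. ?H \<and> N = Transposition.transpose N x z))
      = (\<Sum>x\<in>{1..N - 1}. if x = z then \<P>(\<omega> in M. ?H) else 0)"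
  proof (rule sum.cong[OF refl])
    fix x assume x: "x \<in> {1..N - 1}"
    show "\<P>(\<omega> in M. ?H \<and> N = Transposition.transpose N x z) = (if x = z then \<P>(\<omega> in M. ?H) else 0)"
    proof (cases ?H)
      case True
      then have "y (t - 1) = N" using l by (force dest: bspec[of _ _ "t - 1"])
      then have "N = Transposition.transpose N x z \<longleftrightarrow> x = z"
        using zy x by (cases "z = x") auto
      then show ?thesis by simp
    next
      case False
      then have "{\<omega> \<in> space M. ?H \<and> N = Transposition.transpose N x z} = {}" "{\<omega> \<in> space M. ?H} = {}"
        by blast+
      then show ?thesis by (simp only: measure_empty if_cancel)
    qed
  qed
  also have "\<dots> = \<P>(\<omega> in M. ?H)"
  proof (cases "z = N")
    case True
    then have "{\<omega> \<in> space M. ?H} = {}" using zy l by (force dest: bspec[of _ _ "t - 1"])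
    then show ?thesis by (simp only: measure_empty if_cancel sum.neutral_const)
  next
    case False
    then have "z \<in> {1..N - 1}" using z by auto
    then show ?thesis by (simp only: sum.delta finite_atLeastAtMost if_True)
  qed
  finally show "(\<Sum>x\<in>{1..N - 1}. \<P>(\<omega> in M. ?H \<and> N = Transposition.transpose N x z)) = \<P>(\<omega> in M. ?H)" .
qed

lemma measurable_moved_walk:
  assumes "2 \<le> N" and u: "u \<in> M \<rightarrow>\<^sub>M count_space {1..N}"
  shows "(\<lambda>(a, p, x). p (frame N a t (u x))) \<in> frame_space N M \<rightarrow>\<^sub>M count_space {1..N}"
proof -
  have "(\<lambda>z. (\<lambda>q v. q v) (case z of (a, p, x) \<Rightarrow> p \<circ> frame N a t) (u (case z of (a, p, x) \<Rightarrow> x)))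
      \<in> frame_space N M \<rightarrow>\<^sub>M count_space {1..N}"
    by (rule measurable_combine_discrete[OF measurable_random_frame[OF assms(1)]
          measurable_compose[OF measurable_frame_space_projections(3) u]])
      (auto simp: permutes_in_image countable_permutations simp del: One_nat_def atLeastAtMost_iff)
  then show ?thesis by (simp add: case_prod_beta')
qed

text \<open>The conditional probability, given the labels \<open>a\<close>, that the moved walk takes the values \<open>w\<close> at
  the times in \<open>J\<close>, computed as if the uniform permutation were the frame at time \<open>r\<close>.\<close>

definition history_weight ::
  "nat \<Rightarrow> 'a measure \<Rightarrow> (int \<Rightarrow> 'a \<Rightarrow> nat) \<Rightarrow> int set \<Rightarrow> (int \<Rightarrow> nat) \<Rightarrow> int \<Rightarrow> (int \<Rightarrow> nat) \<Rightarrow> ennreal" where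
  "history_weight N M u J w r a = (\<Sum>p | p permutes {1..N}. ennreal (1 / fact N) *
     emeasure M {x \<in> space M. \<forall>s\<in>J. p (relative_frame N a r s (u s x)) = w s})"

text \<open>The anchor may be moved from time \<open>0\<close> to any time \<open>r\<close>: for fixed labels the frame at time \<open>r\<close>
  is the uniform permutation composed with a fixed one, hence again uniform.\<close>

lemma
  assumes M: "prob_space M" and N: "2 \<le> N" and u: "\<And>s. u s \<in> M \<rightarrow>\<^sub>M count_space {1..N}"
    and "finite J"
  shows emeasure_history:
      "emeasure (frame_space N M) {z \<in> space (frame_space N M).
          \<forall>s\<in>J. (case z of (a, p, x) \<Rightarrow> p (frame N a s (u s x))) = w s}
        = (\<integral>\<^sup>+a. history_weight N M u J w r a \<partial>label_space N)"
    and borel_measurable_history_weight: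
      "history_weight N M u J w r \<in> borel_measurable (label_space N)"
proof -
  define W where "W a = (\<Sum>p | p permutes {1..N}. ennreal (1 / fact N) *
     emeasure M {x \<in> space M. \<forall>s\<in>J. (case (a, p, x) of (a, p, x) \<Rightarrow> p (frame N a s (u s x))) = w s})" for a
  note [measurable] = measurable_count_space_UNIV[OF measurable_moved_walk[OF N u]]
  have E: "{z \<in> space (frame_space N M). \<forall>s\<in>J. (case z of (a, p, x) \<Rightarrow> p (frame N a s (u s x))) = w s}
      \<in> sets (frame_space N M)"
    using \<open>finite J\<close> by measurable
  have eq: "history_weight N M u J w r a = W a" if a: "a \<in> space (label_space N)" for a
  proof -
    have "frame N a r (relative_frame N a r s v) = frame N a s v" for s v
      using frame_comp_relative_frame[where a = a, OF label_in_range[OF a], where r = r and s = s] by (simp add: fun_eq_iff)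
    then show ?thesis
      unfolding history_weight_def W_def
      by (subst sum_permutations_compose_right[OF permutes_frame[where a = a, OF label_in_range[OF a], where t = r]]) simp
  qed
  show "emeasure (frame_space N M) {z \<in> space (frame_space N M).
          \<forall>s\<in>J. (case z of (a, p, x) \<Rightarrow> p (frame N a s (u s x))) = w s}
        = (\<integral>\<^sup>+a. history_weight N M u J w r a \<partial>label_space N)"
    using emeasure_frame_space[OF M N E] unfolding W_def[symmetric] by (simp add: eq cong: nn_integral_cong)
  show "history_weight N M u J w r \<in> borel_measurable (label_space N)"
    using borel_measurable_frame_section[OF M N E] unfolding W_def[symmetric]
    by (simp add: eq cong: measurable_cong)
qed

text \<open>With the anchor at time \<open>t - 1\<close>, changing the label of round \<open>t\<close> leaves the history untouched
  and lets the transposition of round \<open>t\<close> run through all \<open>(N x)\<close>; pulled back to the frame at time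
  \<open>t - 1\<close>, this is exactly the sum in \<open>star_compatible\<close>.\<close>

lemma sum_history_weight_resample:
  assumes M: "prob_space M" and u: "star_compatible N M u" and "2 \<le> N" "1 \<le> l"
    and a: "a \<in> space (label_space N)" and v: "v \<in> {1..N}" "v \<noteq> w (t - 1)"
  shows "(\<Sum>x\<in>{1..N - 1}. history_weight N M u {t - int l..t} (w(t := v)) (t - 1) (a(t := x)))
    = history_weight N M u {t - int l..t - 1} w (t - 1) a"
proof -
  interpret prob_space M by fact
  have um: "u s \<in> M \<rightarrow>\<^sub>M count_space {1..N}" for s
    using u by (simp add: star_compatible_def)
  note [measurable] = measurable_count_space_UNIV[OF um]
  let ?I = "{t - int l..t - 1}"
  have I: "{t - int l..t} = insert t ?I" by auto
  have a': "(a(t := x)) s \<in> {1..N}" if "x \<in> {1..N - 1}" for x s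
    using label_in_range[OF a, of s] that by auto
  have key: "(\<Sum>x\<in>{1..N - 1}. emeasure M {\<omega> \<in> space M. \<forall>s\<in>{t - int l..t}.
        p (relative_frame N (a(t := x)) (t - 1) s (u s \<omega>)) = (w(t := v)) s})
      = emeasure M {\<omega> \<in> space M. \<forall>s\<in>?I. p (relative_frame N a (t - 1) s (u s \<omega>)) = w s}"
    if p: "p permutes {1..N}" for p
  proof -
    define y where "y s = inv (relative_frame N a (t - 1) s) (inv p (w s))" for s
    have past: "p (relative_frame N a (t - 1) s i) = w s \<longleftrightarrow> i = y s" for s i
      using permutes_inv_eq[OF p] permutes_inv_eq[OF permutes_relative_frame[where a = a, OF label_in_range[OF a]]]
      unfolding y_def by metis
    have "relative_frame N a (t - 1) (t - 1) = id"
      using permutes_inv_o(2)[OF permutes_frame[where a = a, OF label_in_range[OF a]]]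
      by (simp add: relative_frame_def)
    then have "y (t - 1) = inv p (w (t - 1))" by (simp add: y_def)
    then have zy: "inv p v \<noteq> y (t - 1)"
      using v permutes_inverses(1)[OF p] by metis
    have z: "inv p v \<in> {1..N}"
      using v permutes_in_image[OF permutes_inv[OF p]] by blast
    have ev: "{\<omega> \<in> space M. \<forall>s\<in>{t - int l..t}.
        p (relative_frame N (a(t := x)) (t - 1) s (u s \<omega>)) = (w(t := v)) s}
      = {\<omega> \<in> space M. (\<forall>s\<in>?I. u s \<omega> = y s) \<and> u t \<omega> = Transposition.transpose N x (inv p v)}"
      if x: "x \<in> {1..N - 1}" for x
    proof -
      have "relative_frame N (a(t := x)) (t - 1) s = relative_frame N a (t - 1) s" if "s \<in> ?I" for s
        using that by (intro relative_frame_past a'[OF x] label_in_range[OF a]) auto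
      moreover have "relative_frame N (a(t := x)) (t - 1) t = Transposition.transpose N x"
        using relative_frame_next[where a = "a(t := x)", OF a'[OF x]] by simp
      moreover have "p (Transposition.transpose N x i) = v \<longleftrightarrow> i = Transposition.transpose N x (inv p v)" for i
        using permutes_inv_eq[OF p] by (metis transpose_involutory)
      ultimately show ?thesis
        unfolding I by (auto simp: past)
    qed
    have "(\<Sum>x\<in>{1..N - 1}. \<P>(\<omega> in M. (\<forall>s\<in>?I. u s \<omega> = y s) \<and> u t \<omega> = Transposition.transpose N x (inv p v)))
        = \<P>(\<omega> in M. \<forall>s\<in>?I. u s \<omega> = y s)"
      using u z zy \<open>1 \<le> l\<close> unfolding star_compatible_def by blast
    then have "(\<Sum>x\<in>{1..N - 1}. emeasure M {\<omega> \<in> space M. (\<forall>s\<in>?I. u s \<omega> = y s) \<and>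
          u t \<omega> = Transposition.transpose N x (inv p v)})
        = emeasure M {\<omega> \<in> space M. \<forall>s\<in>?I. u s \<omega> = y s}"
      by (simp only: emeasure_eq_measure sum_ennreal measure_nonneg)
    then show ?thesis
      by (simp only: past ev cong: sum.cong)
  qed
  show ?thesis
    unfolding history_weight_def
  proof (subst sum.swap, rule sum.cong[OF refl])
    fix p assume "p \<in> {p. p permutes {1..N}}"
    then have p: "p permutes {1..N}" by simp
    show "(\<Sum>x\<in>{1..N - 1}. ennreal (1 / fact N) * emeasure M {\<omega> \<in> space M. \<forall>s\<in>{t - int l..t}.
        p (relative_frame N (a(t := x)) (t - 1) s (u s \<omega>)) = (w(t := v)) s})
      = ennreal (1 / fact N) *
        emeasure M {\<omega> \<in> space M. \<forall>s\<in>?I. p (relative_frame N a (t - 1) s (u s \<omega>)) = w s}"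
      unfolding sum_distrib_left[symmetric] key[OF p] ..
  qed
qed

text \<open>Anchor the frames at time \<open>t - 1\<close>, resample the label of round \<open>t\<close>, and sum: the \<open>N - 1\<close>
  equally likely labels together contribute the probability of the history once.\<close>

theorem simple_random_walk_moving_frame:
  assumes M: "prob_space M" and u: "star_compatible N M u" and N: "2 \<le> N"
  shows "simple_random_walk N (complete_adjacency N) (frame_space N M)
    (\<lambda>t (a, p, x). p (frame N a t (u t x)))" (is "simple_random_walk _ _ ?W ?V")
  unfolding simple_random_walk_def
proof (intro conjI allI impI ballI)
  have um: "u s \<in> M \<rightarrow>\<^sub>M count_space {1..N}" for s
    using u by (simp add: star_compatible_def)
  show "?V t \<in> ?W \<rightarrow>\<^sub>M count_space {1..N}" for t
    by (rule measurable_moved_walk[OF N um])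
  interpret W: prob_space ?W
    using N M by (rule prob_space_frame_space)
  fix t :: int and l :: nat and w :: "int \<Rightarrow> nat" and v
  assume l: "1 \<le> l" and w: "\<forall>s\<in>{t - int l..t - 1}. w s \<in> {1..N}"
    and pos: "0 < \<P>(z in ?W. \<forall>s\<in>{t - int l..t - 1}. ?V s z = w s)"
    and "v \<in> complete_adjacency N `` {w (t - 1)}"
  then have w1: "w (t - 1) \<in> {1..N}" and v: "v \<in> {1..N}" "v \<noteq> w (t - 1)"
    by (auto simp: complete_adjacency_def)
  let ?I = "{t - int l..t - 1}"
  have I: "{t - int l..t} = insert t ?I" by auto
  have E: "{z \<in> space ?W. ?V t z = v \<and> (\<forall>s\<in>?I. ?V s z = w s)}
      = {z \<in> space ?W. \<forall>s\<in>{t - int l..t}. ?V s z = (w(t := v)) s}"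
    unfolding I by (intro Collect_cong conj_cong refl) auto
  have meas: "(\<lambda>a. history_weight N M u J w' r a) \<in> borel_measurable (label_space N)"
    if "finite J" for J w' r
    using borel_measurable_history_weight[where r = r, OF M N um that] .
  have "emeasure ?W {z \<in> space ?W. ?V t z = v \<and> (\<forall>s\<in>?I. ?V s z = w s)}
      = (\<integral>\<^sup>+a. history_weight N M u {t - int l..t} (w(t := v)) (t - 1) a \<partial>label_space N)"
    unfolding E by (rule emeasure_history[OF M N um]) simp
  also have "\<dots> = (\<integral>\<^sup>+a. (\<Sum>x\<in>{1..N - 1}. ennreal (1 / (real N - 1)) *
      history_weight N M u {t - int l..t} (w(t := v)) (t - 1) (a(t := x))) \<partial>label_space N)"
    by (rule nn_integral_resample_label[OF N meas]) simp
  also have "\<dots> = (\<integral>\<^sup>+a. ennreal (1 / (real N - 1)) *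
      history_weight N M u ?I w (t - 1) a \<partial>label_space N)"
    by (intro nn_integral_cong)
      (simp add: sum_distrib_left[symmetric] sum_history_weight_resample[where w = w and t = t, OF M u N l _ v] del: One_nat_def)
  also have "\<dots> = ennreal (1 / (real N - 1)) * emeasure ?W {z \<in> space ?W. \<forall>s\<in>?I. ?V s z = w s}"
    by (subst nn_integral_cmult[OF meas], simp)
      (simp add: emeasure_history[OF M N um, where r = "t - 1"])
  finally have "\<P>(z in ?W. ?V t z = v \<and> (\<forall>s\<in>?I. ?V s z = w s))
      = 1 / (real N - 1) * \<P>(z in ?W. \<forall>s\<in>?I. ?V s z = w s)"
    using N unfolding W.emeasure_eq_measure
    by (subst (asm) ennreal_mult[symmetric], simp_all only: ennreal_inj) (simp_all add: measure_nonneg)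
  then show "\<P>(z in ?W. ?V t z = v \<bar> \<forall>s\<in>?I. ?V s z = w s)
      = 1 / real (card (complete_adjacency N `` {w (t - 1)}))"
    using pos N by (simp add: cond_prob_def complete_adjacency_neighbours(2)[OF w1] of_nat_diff)
qed

section \<open>Inserting the new walker into the order of moves\<close>

text \<open>The cycle that puts \<open>k + 1\<close> at position \<open>q\<close> and shifts the positions from \<open>q\<close> to \<open>k\<close> up
  by one.\<close>

definition make_room :: "nat \<Rightarrow> nat \<Rightarrow> nat \<Rightarrow> nat" where
  "make_room k q i =
     (if i = k + 1 then q else if q \<le> i \<and> i \<le> k then i + 1 else i)"

lemma make_room_permutes:
  assumes "q \<in> {1..k + 1}"
  shows "make_room k q permutes {1..k + 1}"
proof (rule bij_imp_permutes)
  have "inj_on (make_room k q) {1..k + 1}"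
    by (auto simp: inj_on_def make_room_def split: if_splits)
  moreover have "make_room k q ` {1..k + 1} \<subseteq> {1..k + 1}"
    using assms by (auto simp: make_room_def)
  ultimately show "bij_betw (make_room k q) {1..k + 1} {1..k + 1}"
    by (simp add: bij_betw_def endo_inj_surj del: One_nat_def)
qed (use assms in \<open>auto simp: make_room_def\<close>)

lemma make_room_less_iff:
  assumes "i \<le> k" "j \<le> k"
  shows "make_room k q i < make_room k q j \<longleftrightarrow> i < j"
  using assms by (auto simp: make_room_def)

text \<open>The new walker \<open>k + 1\<close> moves right after the last walker of \<open>J\<close>, and first if \<open>J\<close> is empty,
  which is what the position \<open>0\<close> added to the maximum achieves. In the application \<open>J\<close> almost surely
  has at most one element, but a definition valid for all sets keeps the order of moves a permutation
  at every point of the sample space.\<close>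

definition insert_move :: "nat \<Rightarrow> (nat \<Rightarrow> nat) \<Rightarrow> nat set \<Rightarrow> nat \<Rightarrow> nat" where
  "insert_move k \<sigma> J = make_room k (1 + Max (insert 0 (\<sigma> ` J))) \<circ> \<sigma>"

lemma
  assumes \<sigma>: "\<sigma> permutes {1..k}" and J: "J \<subseteq> {1..k}"
  shows insert_move_permutes: "insert_move k \<sigma> J permutes {1..k + 1}"
    and insert_move_less_iff:
      "\<And>i j. i \<in> {1..k} \<Longrightarrow> j \<in> {1..k} \<Longrightarrow> insert_move k \<sigma> J i < insert_move k \<sigma> J j \<longleftrightarrow> \<sigma> i < \<sigma> j"
    and insert_move_before_new:
      "\<And>j. j \<in> J \<Longrightarrow> insert_move k \<sigma> J j < insert_move k \<sigma> J (k + 1)"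
    and insert_move_after_new:
      "\<And>i. i \<in> {1..k} \<Longrightarrow> (\<And>j. j \<in> J \<Longrightarrow> \<sigma> j < \<sigma> i) \<Longrightarrow> insert_move k \<sigma> J (k + 1) < insert_move k \<sigma> J i"
proof -
  define m where "m = Max (insert 0 (\<sigma> ` J))"
  have fin: "finite (insert 0 (\<sigma> ` J))"
    using J by (auto intro: finite_subset)
  have im: "\<sigma> i \<in> {1..k}" if "i \<in> {1..k}" for i
    using that permutes_in_image[OF \<sigma>] by blast
  have new: "\<sigma> (k + 1) = k + 1"
    by (rule permutes_not_in[OF \<sigma>]) simp
  have "m \<in> insert 0 (\<sigma> ` J)"
    unfolding m_def using fin by (intro Max_in) auto
  then have "m \<le> k"
    using im J by fastforce
  then show "insert_move k \<sigma> J permutes {1..k + 1}"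
    unfolding insert_move_def m_def[symmetric]
    by (intro permutes_compose[OF permutes_subset[OF \<sigma>]] make_room_permutes) auto
  show "insert_move k \<sigma> J i < insert_move k \<sigma> J j \<longleftrightarrow> \<sigma> i < \<sigma> j" if "i \<in> {1..k}" "j \<in> {1..k}" for i j
    using im[OF that(1)] im[OF that(2)] by (simp add: insert_move_def make_room_less_iff)
  show "insert_move k \<sigma> J j < insert_move k \<sigma> J (k + 1)" if "j \<in> J" for j
  proof -
    have "\<sigma> j \<le> m" unfolding m_def using fin that by (intro Max_ge) auto
    then show ?thesis
      using im[of j] that J new by (auto simp: insert_move_def make_room_def m_def[symmetric])
  qed
  show "insert_move k \<sigma> J (k + 1) < insert_move k \<sigma> J i"
    if i: "i \<in> {1..k}" and before: "\<And>j. j \<in> J \<Longrightarrow> \<sigma> j < \<sigma> i" for i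
  proof -
    have "m < \<sigma> i"
      unfolding m_def using fin im[OF i] before by (subst Max_less_iff) auto
    then show ?thesis
      using im[OF i] new by (simp add: insert_move_def make_room_def m_def[symmetric])
  qed
qed

section \<open>The enlarged coupling\<close>

text \<open>The definition of a simple random walk prescribes the probabilities of the neighbours only;
  that the walk moves almost surely follows because they add up to one.\<close>

lemma (in prob_space) simple_random_walk_never_stays:
  assumes walk: "simple_random_walk n (complete_adjacency n) M u" and "2 \<le> n"
  shows "AE \<omega> in M. u t \<omega> \<noteq> u (t - 1) \<omega>"
proof -
  have u: "u t \<in> M \<rightarrow>\<^sub>M count_space {1..n}" for t
    using walk by (simp add: simple_random_walk_def)
  note [measurable] = measurable_count_space_UNIV[OF u]
  have "\<P>(\<omega> in M. u (t - 1) \<omega> = c \<and> u t \<omega> = c) = 0" if c: "c \<in> {1..n}" for c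
  proof (cases "\<P>(\<omega> in M. u (t - 1) \<omega> = c) = 0")
    case True
    have "\<P>(\<omega> in M. u (t - 1) \<omega> = c \<and> u t \<omega> = c) \<le> \<P>(\<omega> in M. u (t - 1) \<omega> = c)"
      by (rule finite_measure_mono) (auto, measurable)
    then show ?thesis using True by (simp add: antisym)
  next
    case False
    then have pos: "\<P>(\<omega> in M. u (t - 1) \<omega> = c) > 0"
      by (simp add: zero_less_measure_iff)
    let ?P = "\<lambda>v. \<P>(\<omega> in M. u (t - 1) \<omega> = c \<and> u t \<omega> = v)"
    have I: "{t - int 1..t - 1} = {t - 1}" by auto
    have step: "?P v = \<P>(\<omega> in M. u (t - 1) \<omega> = c) / real (n - 1)" if "v \<in> {1..n} - {c}" for v
    proof -
      have "\<P>(\<omega> in M. u t \<omega> = v \<bar> u (t - 1) \<omega> = c) = 1 / real (n - 1)"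
        using walk[unfolded simple_random_walk_def, THEN conjunct2, rule_format, of 1 t "\<lambda>_. c" v] c pos that
        by (simp add: I complete_adjacency_neighbours[OF c] del: One_nat_def atLeastAtMost_iff)
      then show ?thesis
        using pos \<open>2 \<le> n\<close> by (simp add: cond_prob_def conj_commute field_simps)
    qed
    have "\<P>(\<omega> in M. u (t - 1) \<omega> = c) = (\<Sum>v\<in>{1..n}. ?P v)"
      by (rule sum_prob_values[OF u, symmetric]) simp_all
    also have "\<dots> = ?P c + (\<Sum>v\<in>{1..n} - {c}. ?P v)"
      using c by (intro sum.remove) auto
    also have "(\<Sum>v\<in>{1..n} - {c}. ?P v) = \<P>(\<omega> in M. u (t - 1) \<omega> = c)"
      using c \<open>2 \<le> n\<close> by (simp add: step card_Diff_singleton del: One_nat_def)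
    finally show ?thesis by simp
  qed
  then have "AE \<omega> in M. \<not> (u (t - 1) \<omega> = c \<and> u t \<omega> = c)" if "c \<in> {1..n}" for c
    using that by (subst (asm) prob_eq_0) (auto, measurable)
  then have "AE \<omega> in M. \<forall>c\<in>{1..n}. \<not> (u (t - 1) \<omega> = c \<and> u t \<omega> = c)"
    by (intro AE_finite_allI) auto
  then show ?thesis
    using AE_space
  proof eventually_elim
    case (elim \<omega>)
    have "u t \<omega> \<in> {1..n}" using measurable_space[OF u elim(2), of t] by simp
    then show ?case using elim(1) by auto
  qed
qed

lemma frame_space_prob_eq_0:
  assumes M: "prob_space M" and "2 \<le> N"
    and Q: "{z \<in> space (frame_space N M). Q z} \<in> sets (frame_space N M)"
    and null: "\<And>a p. a \<in> space (label_space N) \<Longrightarrow> p permutes {1..N} \<Longrightarrow> AE x in M. \<not> Q (a, p, x)"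
  shows "\<P>(z in frame_space N M. Q z) = 0"
proof -
  have "emeasure (frame_space N M) {z \<in> space (frame_space N M). Q z} = (\<integral>\<^sup>+a. 0 \<partial>label_space N)"
    unfolding emeasure_frame_space[OF M \<open>2 \<le> N\<close> Q]
  proof (rule nn_integral_cong)
    fix a assume a: "a \<in> space (label_space N)"
    have "emeasure M {x \<in> space M. Q (a, p, x)} = 0" if "p permutes {1..N}" for p
      using null[OF a that] by (rule emeasure_eq_0_AE)
    then show "(\<Sum>p | p permutes {1..N}. ennreal (1 / fact N) * emeasure M {x \<in> space M. Q (a, p, x)}) = 0"
      by simp
  qed
  then show ?thesis by (simp add: measure_def)
qed

text \<open>Extending \<open>U\<close> by the constant label \<open>N\<close> for the walker \<open>k + 1\<close> makes the new walker a walker like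
  the others, seen in the moving frame.\<close>

theorem posac_add_walker:
  assumes N: "3 \<le> N" and R: "partial_order_on {1..k} R"
    and posac: "posac (N - 1) (complete_adjacency (N - 1)) k R M U"
  defines "V \<equiv> \<lambda>t (a, p, x). restrict (p \<circ> frame N a t \<circ> (U t x)(k + 1 := N)) {1..k + 1}"
  shows "posac N (complete_adjacency N) (k + 1) (insert (k + 1, k + 1) R) (frame_space N M) V"
proof -
  let ?W = "frame_space N M"
  from posac obtain \<sigma> where M: "prob_space M"
    and U: "\<And>t. U t \<in> M \<rightarrow>\<^sub>M count_space ({1..k} \<rightarrow>\<^sub>E {1..N - 1})"
    and \<sigma>: "\<And>t. \<sigma> t \<in> M \<rightarrow>\<^sub>M count_space {p. p permutes {1..k}}"
    and resp: "\<And>t x. x \<in> space M \<Longrightarrow> respects_order k R (\<sigma> t x)"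
    and walk: "\<And>i. i \<in> {1..k} \<Longrightarrow> simple_random_walk (N - 1) (complete_adjacency (N - 1)) M (\<lambda>t x. U t x i)"
    and avoid: "\<And>t i j. i \<in> {1..k} \<Longrightarrow> j \<in> {1..k} \<Longrightarrow> i \<noteq> j \<Longrightarrow>
           \<P>(x in M. U t x i = U t x j) = 0 \<and>
           \<P>(x in M. U t x i = U (t - 1) x j \<and> \<sigma> t x i < \<sigma> t x j) = 0"
    unfolding posac_def by blast
  interpret prob_space M by fact
  have N2: "2 \<le> N" using N by simp
  have Ui: "U t x i \<in> {1..N - 1}" if "x \<in> space M" "i \<in> {1..k}" for t x i
    using PiE_mem[of "U t x" "{1..k}" "\<lambda>_. {1..N - 1}" i] measurable_space[OF U that(1), of t] that(2) by simp
  have \<sigma>p: "\<sigma> t x permutes {1..k}" if "x \<in> space M" for t x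
    using measurable_space[OF \<sigma> that] by simp
  have countU: "countable ({1..k} \<rightarrow>\<^sub>E {1..N - 1})"
    by (intro countable_finite finite_PiE) auto
  have countV: "countable ({1..k + 1} \<rightarrow>\<^sub>E {1..N})"
    by (intro countable_finite finite_PiE) auto
  define u where "u t x = (U t x)(k + 1 := N)" for t x
  have u: "u t \<in> M \<rightarrow>\<^sub>M count_space ({1..k + 1} \<rightarrow>\<^sub>E {1..N})" for t
    unfolding u_def
  proof (rule measurable_compose[OF U])
    have "v(k + 1 := N) \<in> {1..k + 1} \<rightarrow>\<^sub>E {1..N}" if v: "v \<in> {1..k} \<rightarrow>\<^sub>E {1..N - 1}" for v
    proof -
      have "v \<in> {1..k} \<rightarrow>\<^sub>E {1..N}"
        by (rule subsetD[OF PiE_mono v]) auto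
      moreover have "{1..k + 1} = insert (k + 1) {1..k}" by auto
      ultimately show ?thesis
        using N by (simp only:) (rule PiE_fun_upd, simp_all)
    qed
    then show "(\<lambda>v. v(k + 1 := N))
        \<in> count_space ({1..k} \<rightarrow>\<^sub>E {1..N - 1}) \<rightarrow>\<^sub>M count_space ({1..k + 1} \<rightarrow>\<^sub>E {1..N})"
      by (simp only: measurable_count_space_eq1 Pi_iff space_count_space) blast
  qed
  have ui: "(\<lambda>x. u t x i) \<in> M \<rightarrow>\<^sub>M count_space {1..N}" if "i \<in> {1..k + 1}" for t i
    by (rule measurable_compose[OF u]) (use that in auto)
  have V: "V t (a, p, x) i = p (frame N a t (u t x i))" if "i \<in> {1..k + 1}" for t a p x i
    using that by (simp add: V_def u_def)

  define \<tau> where "\<tau> t = (\<lambda>(a, p :: nat \<Rightarrow> nat, x). insert_move k (\<sigma> t x) {j \<in> {1..k}. U (t - 1) x j = a t})"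
    for t :: int
  have \<tau>p: "\<tau> t z permutes {1..k + 1}" if "z \<in> space ?W" for t z
    using that \<sigma>p by (cases z) (auto simp: \<tau>_def space_frame_space simp del: One_nat_def intro!: insert_move_permutes)

  have Vm: "V t \<in> ?W \<rightarrow>\<^sub>M count_space ({1..k + 1} \<rightarrow>\<^sub>E {1..N})" for t
  proof -
    have "(\<lambda>z. (\<lambda>q v. restrict (q \<circ> v) {1..k + 1}) (case z of (a, p, x) \<Rightarrow> p \<circ> frame N a t) (u t (case z of (a, p, x) \<Rightarrow> x)))
        \<in> ?W \<rightarrow>\<^sub>M count_space ({1..k + 1} \<rightarrow>\<^sub>E {1..N})"
    proof (rule measurable_combine_discrete[OF measurable_random_frame[OF N2]
          measurable_compose[OF measurable_frame_space_projections(3) u]])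
      show "countable ({1..k + 1} \<rightarrow>\<^sub>E {1..N})" by (rule countV)
      fix q v assume "q \<in> {p. p permutes {1..N}}" "v \<in> {1..k + 1} \<rightarrow>\<^sub>E {1..N}"
      then show "restrict (q \<circ> v) {1..k + 1} \<in> {1..k + 1} \<rightarrow>\<^sub>E {1..N}"
        using permutes_in_image[of q "{1..N}"] by (auto simp: PiE_iff simp del: One_nat_def atLeastAtMost_iff)
    qed (simp add: countable_permutations)
    then show ?thesis by (simp add: V_def u_def case_prod_beta' del: One_nat_def)
  qed

  have \<tau>m: "\<tau> t \<in> ?W \<rightarrow>\<^sub>M count_space {p. p permutes {1..k + 1}}" for t
  proof -
    let ?J = "\<lambda>(v :: nat \<Rightarrow> nat) c. {j \<in> {1..k}. v j = c}"
    have J: "(\<lambda>z. ?J (U (t - 1) (case z of (a, p, x) \<Rightarrow> x)) ((case z of (a, p, x) \<Rightarrow> a) t))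
        \<in> ?W \<rightarrow>\<^sub>M count_space (Pow {1..k})"
      by (rule measurable_combine_discrete[where h = ?J, OF measurable_compose[OF measurable_frame_space_projections(3) U]
            measurable_compose[OF measurable_frame_space_projections(1) measurable_label] countU])
        auto
    have "(\<lambda>z. insert_move k (\<sigma> t (case z of (a, p, x) \<Rightarrow> x))
          (?J (U (t - 1) (case z of (a, p, x) \<Rightarrow> x)) ((case z of (a, p, x) \<Rightarrow> a) t)))
        \<in> ?W \<rightarrow>\<^sub>M count_space {p. p permutes {1..k + 1}}"
      by (rule measurable_combine_discrete[OF measurable_compose[OF measurable_frame_space_projections(3) \<sigma>] J])
        (auto simp: countable_permutations countable_finite intro!: insert_move_permutes simp del: One_nat_def atLeastAtMost_iff)
    then show ?thesis by (simp add: \<tau>_def case_prod_beta' del: One_nat_def)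
  qed

  have Vwalk: "simple_random_walk N (complete_adjacency N) ?W (\<lambda>t z. V t z i)" if i: "i \<in> {1..k + 1}" for i
  proof -
    have "star_compatible N M (\<lambda>t x. u t x i)"
    proof (cases "i = k + 1")
      case True
      then show ?thesis using star_compatible_const[OF N2] by (simp add: u_def)
    next
      case False
      then show ?thesis
        using star_compatible_simple_random_walk[OF M N walk, of i] i by (simp add: u_def)
    qed
    moreover have "(\<lambda>t z. V t z i) = (\<lambda>t (a, p, x). p (frame N a t (u t x i)))"
      using V[OF i] by (simp add: fun_eq_iff)
    ultimately show ?thesis
      using simple_random_walk_moving_frame[OF M _ N2] by simp
  qed

  have \<tau>resp: "respects_order (k + 1) (insert (k + 1, k + 1) R) (\<tau> t z)" if "z \<in> space ?W" for t z
    unfolding respects_order_def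
  proof (intro ballI impI)
    fix i j assume "(i, j) \<in> insert (k + 1, k + 1) R \<and> i \<noteq> j"
    then have ij: "(i, j) \<in> R" "i \<noteq> j" by auto
    then have k: "i \<in> {1..k}" "j \<in> {1..k}"
      using partial_order_onD(4)[OF R] by auto
    obtain a p x where z1: "z = (a, p, x)" by (cases z)
    with that have z: "z = (a, p, x)" "x \<in> space M" by (simp_all add: space_frame_space)
    have "\<sigma> t x i < \<sigma> t x j"
      using resp[OF z(2)] ij k by (auto simp: respects_order_def)
    moreover have "{j \<in> {1..k}. U (t - 1) x j = a t} \<subseteq> {1..k}" by auto
    ultimately show "\<tau> t z i < \<tau> t z j"
      unfolding \<tau>_def z prod.case using insert_move_less_iff[OF \<sigma>p[OF z(2)] _ k] by blast
  qed

  have dist: "AE x in M. \<forall>i\<in>{1..k}. \<forall>j\<in>{1..k}. i \<noteq> j \<longrightarrow> U t x i \<noteq> U t x j \<and>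
        (U t x i = U (t - 1) x j \<longrightarrow> \<sigma> t x j < \<sigma> t x i)" for t
  proof (intro AE_finite_allI finite_atLeastAtMost)
    fix i j assume ij: "i \<in> {1..k}" "j \<in> {1..k}"
    have meas: "Measurable.pred M (\<lambda>x. U t x i = U s x j)" for t s i j
      by (rule measurable_combine_discrete[where h = "\<lambda>u v. u i = v j", OF U U countU countU]) simp
    have measl: "Measurable.pred M (\<lambda>x. \<sigma> t x i < \<sigma> t x j)" for t i j
      by (rule measurable_compose[OF \<sigma>]) simp
    show "AE x in M. i \<noteq> j \<longrightarrow> U t x i \<noteq> U t x j \<and> (U t x i = U (t - 1) x j \<longrightarrow> \<sigma> t x j < \<sigma> t x i)"
    proof (cases "i = j")
      case False
      have "{x \<in> space M. U t x i = U t x j} \<in> sets M"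
        "{x \<in> space M. U t x i = U (t - 1) x j \<and> \<sigma> t x i < \<sigma> t x j} \<in> sets M"
        using meas[of t i t j] pred_intros_logic(3)[OF meas[of t i "t - 1" j] measl[of t i j]]
        by (simp_all add: pred_def)
      note prob_eq_0[OF this(1)] prob_eq_0[OF this(2)]
      then have "AE x in M. \<not> U t x i = U t x j"
        and "AE x in M. \<not> (U t x i = U (t - 1) x j \<and> \<sigma> t x i < \<sigma> t x j)"
        using avoid[OF ij False, of t] by simp_all
      then show ?thesis
        using AE_space
      proof eventually_elim
        case (elim x)
        have "\<sigma> t x i \<noteq> \<sigma> t x j"
          using permutes_inj[OF \<sigma>p[OF elim(3)]] False by (simp add: inj_eq)
        then show ?case using elim by auto
      qed
    qed simp
  qed
  have move: "AE x in M. \<forall>i\<in>{1..k}. U t x i \<noteq> U (t - 1) x i" for t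
    using N by (intro AE_finite_allI simple_random_walk_never_stays[OF walk]) auto

  have Vavoid: "\<P>(z in ?W. V t z i = V t z j) = 0 \<and>
      \<P>(z in ?W. V t z i = V (t - 1) z j \<and> \<tau> t z i < \<tau> t z j) = 0"
    if i: "i \<in> {1..k + 1}" and j: "j \<in> {1..k + 1}" and "i \<noteq> j" for t i j
  proof
    have meas: "Measurable.pred ?W (\<lambda>z. V t z i = V s z j)" for t s i j
      by (rule measurable_combine_discrete[where h = "\<lambda>u v. u i = v j", OF Vm Vm countV countV]) simp
    have measl: "Measurable.pred ?W (\<lambda>z. \<tau> t z i < \<tau> t z j)" for t i j
      by (rule measurable_compose[OF \<tau>m]) simp
    have E1: "{z \<in> space ?W. V t z i = V t z j} \<in> sets ?W"
      using meas[of t i t j] by (simp add: pred_def)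
    have E2: "{z \<in> space ?W. V t z i = V (t - 1) z j \<and> \<tau> t z i < \<tau> t z j} \<in> sets ?W"
      using pred_intros_logic(3)[OF meas[of t i "t - 1" j] measl[of t i j]] by (simp add: pred_def)
    have inj: "p (frame N a t c) = p (frame N a t d) \<longleftrightarrow> c = d"
      if "a \<in> space (label_space N)" "p permutes {1..N}" for a p t c d
      using permutes_inj[OF that(2)] permutes_inj[OF permutes_frame[where a = a, OF label_in_range[OF that(1)]]]
      by (simp add: inj_eq)
    show "\<P>(z in ?W. V t z i = V t z j) = 0"
    proof (rule frame_space_prob_eq_0[OF M N2 E1])
      fix a p assume "a \<in> space (label_space N)" "p permutes {1..N}"
      note inj = inj[OF this]
      show "AE x in M. V t (a, p, x) i \<noteq> V t (a, p, x) j"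
        using dist[of t] AE_space
      proof eventually_elim
        case (elim x)
        have "U t x i \<noteq> N" if "i \<in> {1..k}" for i
          using Ui[OF elim(2) that, of t] N by auto
        then have "u t x i \<noteq> u t x j"
          using elim i j \<open>i \<noteq> j\<close> by (auto simp: u_def le_Suc_eq)
        then show ?case by (simp add: V[OF i] V[OF j] inj)
      qed
    qed
    show "\<P>(z in ?W. V t z i = V (t - 1) z j \<and> \<tau> t z i < \<tau> t z j) = 0"
    proof (rule frame_space_prob_eq_0[OF M N2 E2])
      fix a p assume a: "a \<in> space (label_space N)" and p: "p permutes {1..N}"
      show "AE x in M. \<not> (V t (a, p, x) i = V (t - 1) (a, p, x) j \<and> \<tau> t (a, p, x) i < \<tau> t (a, p, x) j)"
        using dist[of t] move[of t] AE_space
      proof eventually_elim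
        case (elim x)
        let ?J = "{j \<in> {1..k}. U (t - 1) x j = a t}"
        have aN: "a t \<noteq> N" using a[unfolded space_label_space, rule_format, of t] N by auto
        have UN: "U s x i \<noteq> N" if "i \<in> {1..k}" for s i
          using Ui[OF elim(3) that, of s] N by auto
        have ins: "?J \<subseteq> {1..k}" by auto
        note order = \<sigma>p[OF elim(3), of t] ins
        \<comment> \<open>The event requires \<open>i\<close> to move before \<open>j\<close>, so it is enough that it moves after \<open>j\<close>.\<close>
        have "\<tau> t (a, p, x) j < \<tau> t (a, p, x) i" if eq: "V t (a, p, x) i = V (t - 1) (a, p, x) j"
        proof -
          \<comment> \<open>In the frame at time \<open>t - 1\<close>, walker \<open>i\<close> moves to the transposed label.\<close>
          have hop: "Transposition.transpose N (a t) (u t x i) = u (t - 1) x j"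
            using eq frame_step[of N a t] by (simp add: V[OF i] V[OF j] inj[OF a p])
          consider "i = k + 1" "j \<in> {1..k}" | "j = k + 1" "i \<in> {1..k}" | "i \<in> {1..k}" "j \<in> {1..k}"
            using i j \<open>i \<noteq> j\<close> by force
          then show ?thesis
          proof cases
            case 1
            then have "j \<in> ?J" using hop by (simp add: u_def)
            then show ?thesis
              using insert_move_before_new[OF order] 1 by (simp add: \<tau>_def)
          next
            case 2
            then have ia: "U t x i = a t"
              using hop aN UN by (auto simp: u_def transpose_eq_iff split: if_splits)
            \<comment> \<open>In the given coupling \<open>i\<close> takes the place of \<open>j'\<close>; they differ because \<open>i\<close> does not
              stay in place.\<close>
            have "\<sigma> t x j' < \<sigma> t x i" if "j' \<in> ?J" for j'
            proof -
              have "i \<noteq> j'" using that ia bspec[OF elim(2) 2(2)] by auto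
              then show ?thesis
                using bspec[OF bspec[OF elim(1) 2(2)], of j'] that ia by simp
            qed
            then show ?thesis
              using insert_move_after_new[OF order 2(2)] 2 by (simp add: \<tau>_def)
          next
            case 3
            \<comment> \<open>Neither \<open>U t x i\<close> nor its image under the transposition is \<open>N\<close>, so it is fixed.\<close>
            have "U t x i = U (t - 1) x j"
              using hop 3 UN by (auto simp: u_def Transposition.transpose_def split: if_splits)
            then have "\<sigma> t x j < \<sigma> t x i" using elim(1) 3 \<open>i \<noteq> j\<close> by auto
            then show ?thesis
              using insert_move_less_iff[OF order 3(2,1)] by (simp add: \<tau>_def)
          qed
        qed
        then show ?case by auto
      qed
    qed
  qed
  show ?thesis
    unfolding posac_def
    using prob_space_frame_space[OF N2 M] Vm \<tau>m \<tau>resp Vwalk Vavoid by blast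
qed

theorem theorem3:
  fixes N k :: nat and R :: "nat rel"
  assumes "N \<ge> 3" and "k \<ge> 1"
    and "partial_order_on {1..k} R"
    and "\<exists>(M :: 'a measure) U. posac (N - 1) (complete_adjacency (N - 1)) k R M U"
  shows "\<exists>(M :: trajectory measure) U.
           posac N (complete_adjacency N) (k + 1) (insert (k + 1, k + 1) R) M U"
proof -
  obtain M :: "'a measure" and U where "posac (N - 1) (complete_adjacency (N - 1)) k R M U"
    using assms(4) by blast
  from posac_add_walker[OF assms(1,3) this] show ?thesis
    by (rule posac_imp_posac_trajectory)
qed

end
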